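(* Let $g \in \mathrm{Aut}(\mathbb{S}) \setminus \{\mathrm{id}\}$, where $\mathbb{S}$ is the semigeneric tournament. Then there are infinitely many parts $P$ of $\mathbb{S}$ such that $gP \neq P$ (that is, $P$ is not fixed setwise by $g$).
   Context: An oriented graph is a set with an irreflexive antisymmetric relation $\to$. Write $u\perp v$ if there is no edge between $u$ and $v$ in either direction (so $u\perp u$). An oriented graph is an $\omega$-partite tournament if $\perp$ is an equivalence relation on it; the equivalence classes are called parts. Let $\mathcal{S}$ be the class of finite $\omega$-partite tournaments satisfying the parity condition: for any two pairs $\{u,u'\}$ and $\{v,v'\}$ of vertices with $u\perp u'$, $v\perp v'$ (two distinct vertices in each pair) lying in two different parts, the number of edges directed from a vertex of $\{u,u'\}$ to a vertex of $\{v,v'\}$ is even. $\mathcal{S}$ is a Fraïssé class, and the semigeneric tournament $\mathbb{S}$ is its Fraïssé limit: the unique up to isomorphism countable ultrahomogeneous oriented graph whose finite substructures are, up to isomorphism, exactly the members of $\mathcal{S}$. *)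

theory Defs
  imports "HOL-Library.Countable_Set" "HOL-Combinatorics.Permutations"
begin

text \<open>
  A graph is given by a vertex set \<open>V\<close> and a relation \<open>E\<close>, where \<open>(u, v) \<in> E\<close> means
  that there is an edge from \<open>u\<close> to \<open>v\<close>. The substructure induced on \<open>A \<subseteq> V\<close> has the
  edge relation \<open>Restr E A\<close>.
\<close>

definition oriented_graph :: "'a set \<Rightarrow> 'a rel \<Rightarrow> bool" where
  "oriented_graph V E \<longleftrightarrow> E \<subseteq> V \<times> V \<and> irrefl_on V E \<and> antisym_on V E"

definition perp :: "'a set \<Rightarrow> 'a rel \<Rightarrow> 'a rel" where
  "perp V E = {(u, v) \<in> V \<times> V. (u, v) \<notin> E \<and> (v, u) \<notin> E}"

definition parts :: "'a set \<Rightarrow> 'a rel \<Rightarrow> 'a set set" where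
  "parts V E = V // perp V E"

definition omega_partite_tournament :: "'a set \<Rightarrow> 'a rel \<Rightarrow> bool" where
  "omega_partite_tournament V E \<longleftrightarrow> oriented_graph V E \<and> equiv V (perp V E)"

definition parity_condition :: "'a set \<Rightarrow> 'a rel \<Rightarrow> bool" where
  "parity_condition V E \<longleftrightarrow>
    (\<forall>P\<in>parts V E. \<forall>Q\<in>parts V E. P \<noteq> Q \<longrightarrow>
      (\<forall>u\<in>P. \<forall>u'\<in>P. \<forall>v\<in>Q. \<forall>v'\<in>Q. u \<noteq> u' \<longrightarrow> v \<noteq> v' \<longrightarrow>
        even (card (E \<inter> {u, u'} \<times> {v, v'}))))"

definition semigeneric_class :: "'a set \<Rightarrow> 'a rel \<Rightarrow> bool" where
  "semigeneric_class V E \<longleftrightarrow>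
    finite V \<and> omega_partite_tournament V E \<and> parity_condition V E"

definition graph_iso :: "('a \<Rightarrow> 'b) \<Rightarrow> 'a set \<Rightarrow> 'a rel \<Rightarrow> 'b set \<Rightarrow> 'b rel \<Rightarrow> bool" where
  "graph_iso f V E W F \<longleftrightarrow>
    bij_betw f V W \<and> (\<forall>x\<in>V. \<forall>y\<in>V. (x, y) \<in> E \<longleftrightarrow> (f x, f y) \<in> F)"

text \<open>
  Automorphisms are maps on the whole type that are the identity outside \<open>V\<close> (this is part of
  \<^const>\<open>permutes\<close>), so that the identity automorphism is exactly \<^const>\<open>id\<close>.
\<close>

definition Aut :: "'a set \<Rightarrow> 'a rel \<Rightarrow> ('a \<Rightarrow> 'a) set" where
  "Aut V E = {g. g permutes V \<and> graph_iso g V E V E}"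

definition ultrahomogeneous :: "'a set \<Rightarrow> 'a rel \<Rightarrow> bool" where
  "ultrahomogeneous V E \<longleftrightarrow>
    (\<forall>A B f. finite A \<longrightarrow> A \<subseteq> V \<longrightarrow> B \<subseteq> V \<longrightarrow> graph_iso f A (Restr E A) B (Restr E B) \<longrightarrow>
      (\<exists>g\<in>Aut V E. \<forall>x\<in>A. g x = f x))"

text \<open>
  The last two clauses say that the finite substructures are, up to isomorphism, exactly the
  members of the class. The class is closed under isomorphism and every finite graph is isomorphic
  to one whose vertices are natural numbers, so nothing is lost by letting \<open>W\<close> range over sets of
  natural numbers only.
\<close>

definition semigeneric_tournament :: "'a set \<Rightarrow> 'a rel \<Rightarrow> bool" where
  "semigeneric_tournament V E \<longleftrightarrow>
    oriented_graph V E \<and> countable V \<and> ultrahomogeneous V E \<and>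
    (\<forall>A. finite A \<longrightarrow> A \<subseteq> V \<longrightarrow> semigeneric_class A (Restr E A)) \<and>
    (\<forall>(W :: nat set) F. semigeneric_class W F \<longrightarrow>
      (\<exists>A f. finite A \<and> A \<subseteq> V \<and> graph_iso f W F A (Restr E A)))"

end

theory Submission
  imports Defs
begin

text \<open>
  A vertex of a new part may be joined to any finite set of vertices in any prescribed way: its part
  is a singleton in the one-point extension, so the parity condition does not constrain it. Suppose
  that \<open>g\<close> moves only finitely many parts, and let \<open>g v \<noteq> v\<close>. If the part of \<open>v\<close> is moved, a vertex
  \<open>u\<close> with \<open>u \<rightarrow> v\<close> and \<open>g v \<rightarrow> u\<close> outside the moved parts satisfies \<open>g u \<noteq> u\<close>, so we may assume
  that \<open>g v \<bottom> v\<close>. Take a third vertex \<open>w\<close> in this part, and a vertex \<open>u\<close> outside the moved parts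
  whose edges distinguish \<open>v\<close> from \<open>g v\<close> but not \<open>w\<close> from \<open>g w\<close>. The parity condition fails for the
  pairs \<open>{u, g u}\<close> and \<open>{g v, g w}\<close>.
\<close>

section \<open>Non-adjacency and the parity condition in general graphs\<close>

lemma perp_iff: "(u, v) \<in> perp V E \<longleftrightarrow> u \<in> V \<and> v \<in> V \<and> (u, v) \<notin> E \<and> (v, u) \<notin> E"
  by (auto simp: perp_def)

lemma perp_Restr: "A \<subseteq> V \<Longrightarrow> perp A (Restr E A) = Restr (perp V E) A"
  by (auto simp: perp_def)

text \<open>The row \<open>{u} \<times> {v, v'}\<close> contains an even number of edges exactly
  when \<open>u\<close> treats \<open>v\<close> and \<open>v'\<close> alike, so the total is even
  iff both rows agree in this respect.\<close>

lemma even_card_edges_iff: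
  assumes "u \<noteq> u'" "v \<noteq> v'"
  shows "even (card (E \<inter> {u, u'} \<times> {v, v'})) \<longleftrightarrow>
    (((u, v) \<in> E \<longleftrightarrow> (u, v') \<in> E) \<longleftrightarrow> ((u', v) \<in> E \<longleftrightarrow> (u', v') \<in> E))"
proof -
  have "{u, u'} \<times> {v, v'} = {(u, v), (u, v'), (u', v), (u', v')}"
    by auto
  then show ?thesis
    using assms by (simp add: Int_insert_right)
qed

lemma equiv_perpI:
  assumes "irrefl_on V E"
    and "\<And>x y z. (x, y) \<in> perp V E \<Longrightarrow> (y, z) \<in> perp V E \<Longrightarrow> (x, z) \<in> perp V E"
  shows "equiv V (perp V E)"
proof (intro equivI)
  show "perp V E \<subseteq> V \<times> V"
    by (auto simp: perp_def)
  show "refl_on V (perp V E)"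
    using assms(1) by (auto simp: refl_on_def perp_def irrefl_on_def)
  show "sym (perp V E)"
    by (auto simp: sym_def perp_def)
  show "trans (perp V E)"
    using assms(2) by (auto intro: transI)
qed

text \<open>Phrased by four vertices instead of two classes, the condition combines with
  \<open>perp_Restr\<close> to be read off induced substructures, and can be checked on a
  constructed graph without computing its quotient.\<close>

lemma parity_condition_iff:
  assumes eq: "equiv V (perp V E)"
  shows "parity_condition V E \<longleftrightarrow>
    (\<forall>u u' v v'. (u, u') \<in> perp V E \<longrightarrow> (v, v') \<in> perp V E \<longrightarrow> (u, v) \<notin> perp V E \<longrightarrow>
      u \<noteq> u' \<longrightarrow> v \<noteq> v' \<longrightarrow>
      (((u, v) \<in> E \<longleftrightarrow> (u, v') \<in> E) \<longleftrightarrow> ((u', v) \<in> E \<longleftrightarrow> (u', v') \<in> E)))" (is "_ \<longleftrightarrow> ?R")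
proof
  assume pc: "parity_condition V E"
  show ?R
  proof (intro allI impI)
    fix u u' v v'
    assume h: "(u, u') \<in> perp V E" "(v, v') \<in> perp V E" "(u, v) \<notin> perp V E" "u \<noteq> u'" "v \<noteq> v'"
    have V: "u \<in> V" "v \<in> V"
      using h by (auto simp: perp_def)
    let ?P = "perp V E `` {u}" and ?Q = "perp V E `` {v}"
    have "?P \<in> parts V E" "?Q \<in> parts V E"
      using V by (auto simp: parts_def intro: quotientI)
    moreover have "?P \<noteq> ?Q"
      using h(3) eq_equiv_class[OF _ eq V(2)] by blast
    moreover have "u \<in> ?P" "u' \<in> ?P" "v \<in> ?Q" "v' \<in> ?Q"
      using h equiv_class_self[OF eq] V by auto
    ultimately have "even (card (E \<inter> {u, u'} \<times> {v, v'}))"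
      using pc[unfolded parity_condition_def, rule_format, of ?P ?Q u u' v v'] h(4,5) by simp
    then show "((u, v) \<in> E \<longleftrightarrow> (u, v') \<in> E) \<longleftrightarrow> ((u', v) \<in> E \<longleftrightarrow> (u', v') \<in> E)"
      by (simp only: even_card_edges_iff[OF h(4,5)])
  qed
next
  assume R: ?R
  show "parity_condition V E"
    unfolding parity_condition_def parts_def
  proof (intro ballI impI)
    fix P Q u u' v v'
    assume P: "P \<in> V // perp V E" and Q: "Q \<in> V // perp V E" and ne: "P \<noteq> Q"
      and el: "u \<in> P" "u' \<in> P" "v \<in> Q" "v' \<in> Q" and d: "u \<noteq> u'" "v \<noteq> v'"
    have "(u, u') \<in> perp V E" "(v, v') \<in> perp V E" "(u, v) \<notin> perp V E"
      using quotient_eq_iff[OF eq P P el(1,2)] quotient_eq_iff[OF eq Q Q el(3,4)]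
        quotient_eq_iff[OF eq P Q el(1,3)] ne by auto
    then show "even (card (E \<inter> {u, u'} \<times> {v, v'}))"
      unfolding even_card_edges_iff[OF d] using R d by blast
  qed
qed

section \<open>The semigeneric tournament: conditions inherited from finite substructures, and
  extension of embeddings\<close>

context
  fixes V :: "'a set" and E :: "'a rel"
  assumes st: "semigeneric_tournament V E"
begin

lemma oriented: "oriented_graph V E"
  and homogeneous: "ultrahomogeneous V E"
  and finite_substructure: "finite A \<Longrightarrow> A \<subseteq> V \<Longrightarrow> semigeneric_class A (Restr E A)"
  and universal: "semigeneric_class (W :: nat set) F \<Longrightarrow>
    \<exists>A f. finite A \<and> A \<subseteq> V \<and> graph_iso f W F A (Restr E A)"
  using st by (auto simp: semigeneric_tournament_def)

text \<open>Transitivity involves only three vertices, so it is inherited from the finite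
  substructure on \<open>{x, y, z}\<close>.\<close>

lemma equiv_perp: "equiv V (perp V E)"
proof (rule equiv_perpI)
  show "irrefl_on V E"
    using oriented by (simp add: oriented_graph_def)
next
  fix x y z
  assume h: "(x, y) \<in> perp V E" "(y, z) \<in> perp V E"
  let ?A = "{x, y, z}"
  have A: "?A \<subseteq> V"
    using h by (auto simp: perp_def)
  then have "trans (perp ?A (Restr E ?A))"
    using finite_substructure[of ?A]
    by (auto simp: semigeneric_class_def omega_partite_tournament_def equiv_def)
  then show "(x, z) \<in> perp V E"
    using h unfolding perp_Restr[OF A] by (blast dest: transD)
qed

text \<open>A condition on four vertices, again inherited from a finite substructure. Admitting
  \<open>u = u'\<close>, where the claim is trivial, saves a case distinction when it is applied to
  \<open>u\<close> and \<open>g u\<close>.\<close>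

lemma parity:
  assumes "(u, u') \<in> perp V E" "(v, v') \<in> perp V E" "(u, v) \<notin> perp V E" "v \<noteq> v'"
  shows "((u, v) \<in> E \<longleftrightarrow> (u, v') \<in> E) \<longleftrightarrow> ((u', v) \<in> E \<longleftrightarrow> (u', v') \<in> E)"
proof (cases "u = u'")
  case False
  let ?A = "{u, u', v, v'}"
  have A: "?A \<subseteq> V"
    using assms by (auto simp: perp_def)
  have "equiv ?A (perp ?A (Restr E ?A))" "parity_condition ?A (Restr E ?A)"
    using finite_substructure[OF _ A]
    by (auto simp: semigeneric_class_def omega_partite_tournament_def)
  from this(2)[unfolded parity_condition_iff[OF this(1)] perp_Restr[OF A], rule_format,
      of u u' v v'] show ?thesis
    using assms False by simp
qed simp

lemma edge_asym: "(u, v) \<in> E \<Longrightarrow> (v, u) \<notin> E"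
  using oriented by (auto simp: oriented_graph_def antisym_on_def irrefl_on_def)

text \<open>Universality places a copy of \<open>W\<close> somewhere in \<open>V\<close>;
  homogeneity then yields an automorphism moving the part of this copy that represents
  \<open>U\<close> onto the prescribed \<open>A\<close>.\<close>

lemma embedding_extends:
  assumes "semigeneric_class (W :: nat set) F" "U \<subseteq> W" "A \<subseteq> V"
    and e: "graph_iso e U (Restr F U) A (Restr E A)"
  shows "\<exists>h. inj_on h W \<and> h ` W \<subseteq> V \<and> (\<forall>i\<in>U. h i = e i) \<and>
    (\<forall>i\<in>W. \<forall>j\<in>W. (h i, h j) \<in> E \<longleftrightarrow> (i, j) \<in> F)"
proof -
  obtain B f where B: "finite B" "B \<subseteq> V" and f: "graph_iso f W F B (Restr E B)"
    using universal[OF assms(1)] by blast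
  have f_inj: "inj_on f W" and f_img: "f ` W = B"
    using f by (auto simp: graph_iso_def bij_betw_def)
  have f_edge: "(f i, f j) \<in> E \<longleftrightarrow> (i, j) \<in> F" if "i \<in> W" "j \<in> W" for i j
    using f that f_img by (auto simp: graph_iso_def)
  define k where "k = e \<circ> inv_into W f"
  have k: "k (f i) = e i" if "i \<in> U" for i
    using that assms(2) f_inj by (auto simp: k_def)
  have e_bij: "bij_betw e U A"
    and e_edge: "\<And>i j. i \<in> U \<Longrightarrow> j \<in> U \<Longrightarrow> (e i, e j) \<in> E \<longleftrightarrow> (i, j) \<in> F"
    using e by (auto simp: graph_iso_def dest: bij_betwE)
  have "bij_betw k (f ` U) A"
    using e_bij assms(2) f_inj k by (auto simp: bij_betw_def inj_on_def image_image)
  moreover have "(x, y) \<in> Restr E (f ` U) \<longleftrightarrow> (k x, k y) \<in> Restr E A"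
    if xy: "x \<in> f ` U" "y \<in> f ` U" for x y
  proof -
    obtain i j where ij: "x = f i" "y = f j" "i \<in> U" "j \<in> U"
      using xy by blast
    have "e i \<in> A" "e j \<in> A"
      using ij e_bij by (auto dest: bij_betwE)
    then show ?thesis
      using xy ij k e_edge[of i j] f_edge[of i j] assms(2) by auto
  qed
  ultimately have "graph_iso k (f ` U) (Restr E (f ` U)) A (Restr E A)"
    by (simp add: graph_iso_def)
  moreover have "f ` U \<subseteq> V" "finite (f ` U)"
    using assms(2) f_img B by (auto intro: finite_subset)
  ultimately obtain g where g: "g \<in> Aut V E" "\<forall>x\<in>f ` U. g x = k x"
    using homogeneous[unfolded ultrahomogeneous_def, rule_format, of "f ` U" A k] assms(3) by blast
  have g_perm: "g permutes V" and g_edge: "\<And>x y. x \<in> V \<Longrightarrow> y \<in> V \<Longrightarrow> (g x, g y) \<in> E \<longleftrightarrow> (x, y) \<in> E"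
    using g(1) by (auto simp: Aut_def graph_iso_def)
  have fV: "f i \<in> V" if "i \<in> W" for i
    using that f_img B by blast
  have "inj_on (g \<circ> f) W"
    using f_inj permutes_inj[OF g_perm] by (auto intro: comp_inj_on inj_on_subset)
  moreover have "(g \<circ> f) ` W \<subseteq> V"
    using fV permutes_in_image[OF g_perm] by auto
  moreover have "\<forall>i\<in>U. (g \<circ> f) i = e i"
    using g(2) k by simp
  moreover have "\<forall>i\<in>W. \<forall>j\<in>W. ((g \<circ> f) i, (g \<circ> f) j) \<in> E \<longleftrightarrow> (i, j) \<in> F"
    using g_edge fV f_edge by simp
  ultimately show ?thesis
    by blast
qed

lemma vertex_with_prescribed_edges:
  assumes "finite A" "A \<subseteq> V"
  shows "\<exists>z\<in>V. \<forall>a\<in>A. ((z, a) \<in> E \<longleftrightarrow> a \<in> S) \<and> ((a, z) \<in> E \<longleftrightarrow> a \<notin> S)"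
proof -
  define n where "n = card A"
  obtain e where e: "bij_betw e {..<n} A"
    using ex_bij_betw_nat_finite[OF assms(1)] by (auto simp: n_def atLeast0LessThan)
  have eA: "e i \<in> A" if "i < n" for i
    using e that by (auto dest: bij_betwE)
  have eV: "e i \<in> V" if "i < n" for i
    using eA[OF that] assms(2) by blast
  have e_inj: "i = j" if "e i = e j" "i < n" "j < n" for i j
    using e that by (auto simp: bij_betw_def inj_on_def)
  \<comment> \<open>The one-point extension of \<open>A\<close>, labelled by natural numbers as
    universality demands: \<open>i < n\<close> stands for \<open>e i\<close>, and \<open>n\<close>
    is the new vertex, with edges to the members of \<open>S\<close> and from all others.\<close>
  define F where "F = {(i, j). i \<le> n \<and> j \<le> n \<and>
    (if i = n then j < n \<and> e j \<in> S else if j = n then e i \<notin> S else (e i, e j) \<in> E)}"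
  have F_old: "(i, j) \<in> F \<longleftrightarrow> (e i, e j) \<in> E" if "i < n" "j < n" for i j
    using that by (simp add: F_def)
  have F_new: "(n, j) \<in> F \<longleftrightarrow> e j \<in> S" "(j, n) \<in> F \<longleftrightarrow> e j \<notin> S" if "j < n" for j
    using that by (auto simp: F_def)
  have F_nn: "(n, n) \<notin> F"
    by (simp add: F_def)
  \<comment> \<open>The vertex \<open>n\<close> is adjacent to every other one, hence alone in its
    part.\<close>
  have perp_F: "(i, j) \<in> perp {..n} F \<longleftrightarrow>
      i = n \<and> j = n \<or> i < n \<and> j < n \<and> (e i, e j) \<in> perp V E" for i j
  proof (cases "i < n \<and> j < n")
    case True
    then show ?thesis
      using eV by (simp add: perp_iff F_old)
  next
    case False
    then show ?thesis
      using F_new F_nn by (cases i n rule: linorder_cases; cases j n rule: linorder_cases)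
        (auto simp: perp_iff)
  qed
  have F_sub: "F \<subseteq> {..n} \<times> {..n}"
    by (auto simp: F_def)
  have irr: "irrefl_on {..n} F"
    using edge_asym by (auto simp: irrefl_on_def F_def)
  have "antisym_on {..n} F"
    using edge_asym by (auto simp: antisym_on_def F_def split: if_splits)
  then have og: "oriented_graph {..n} F"
    using irr F_sub by (simp add: oriented_graph_def)
  have eq: "equiv {..n} (perp {..n} F)"
  proof (rule equiv_perpI[OF irr])
    fix x y z
    assume "(x, y) \<in> perp {..n} F" "(y, z) \<in> perp {..n} F"
    then show "(x, z) \<in> perp {..n} F"
      using equiv_perp unfolding perp_F equiv_def by (blast dest: transD)
  qed
  have "parity_condition {..n} F"
    unfolding parity_condition_iff[OF eq]
  proof (intro allI impI)
    fix u u' v v'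
    assume h: "(u, u') \<in> perp {..n} F" "(v, v') \<in> perp {..n} F" "(u, v) \<notin> perp {..n} F"
      "u \<noteq> u'" "v \<noteq> v'"
    \<comment> \<open>A pair of distinct vertices in one part cannot contain \<open>n\<close>, so
      all four vertices are old and the parity condition of \<open>E\<close> applies.\<close>
    have lt: "u < n" "u' < n" "v < n" "v' < n"
      and p: "(e u, e u') \<in> perp V E" "(e v, e v') \<in> perp V E" "(e u, e v) \<notin> perp V E"
      using h by (auto simp: perp_F)
    show "((u, v) \<in> F \<longleftrightarrow> (u, v') \<in> F) \<longleftrightarrow> ((u', v) \<in> F \<longleftrightarrow> (u', v') \<in> F)"
      using parity[OF p] e_inj[of v v'] h(5) lt by (auto simp: F_old)
  qed
  then have "semigeneric_class {..n} F"
    using og eq by (simp add: semigeneric_class_def omega_partite_tournament_def)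
  moreover have "graph_iso e {..<n} (Restr F {..<n}) A (Restr E A)"
    using e F_old eA by (simp add: graph_iso_def)
  ultimately obtain h where h: "h ` {..n} \<subseteq> V" "\<forall>i\<in>{..<n}. h i = e i"
    "\<forall>i\<in>{..n}. \<forall>j\<in>{..n}. (h i, h j) \<in> E \<longleftrightarrow> (i, j) \<in> F"
    using embedding_extends[of "{..n}" F "{..<n}" A e, OF _ _ assms(2)]
    by (metis lessThan_subset_iff lessThan_Suc_atMost le_SucI order_refl)
  have "((h n, a) \<in> E \<longleftrightarrow> a \<in> S) \<and> ((a, h n) \<in> E \<longleftrightarrow> a \<notin> S)" if a: "a \<in> A" for a
  proof -
    obtain j where "j < n" "a = e j"
      using a bij_betw_imp_surj_on[OF e] by blast
    then show ?thesis
      using h(2) h(3)[rule_format, of n j] h(3)[rule_format, of j n] F_new[of j] by simp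
  qed
  then show ?thesis
    using h(1) by blast
qed

text \<open>The edgeless graph on three points is in the class, since every edge count in it is
  zero. The embedding of two of its points onto \<open>v\<close> and \<open>v'\<close> extends to
  the third.\<close>

lemma third_vertex_in_part:
  assumes "(v, v') \<in> perp V E" "v \<noteq> v'"
  shows "\<exists>w. (v, w) \<in> perp V E \<and> w \<noteq> v \<and> w \<noteq> v'"
proof -
  let ?W = "{0, 1, 2} :: nat set"
  have eq: "equiv ?W (perp ?W {})"
    by (rule equiv_perpI) (auto simp: perp_iff irrefl_on_def)
  have "semigeneric_class ?W {}"
    using eq by (simp add: semigeneric_class_def omega_partite_tournament_def oriented_graph_def
        parity_condition_def irrefl_on_def antisym_on_def)
  moreover have "graph_iso (\<lambda>i. if i = 0 then v else v') {0, 1} (Restr {} {0, 1 :: nat})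
      {v, v'} (Restr E {v, v'})"
    using assms edge_asym by (auto simp: graph_iso_def bij_betw_def perp_iff)
  ultimately obtain h where h: "inj_on h ?W" "h ` ?W \<subseteq> V" "h 0 = v" "h 1 = v'"
    "\<forall>i\<in>?W. \<forall>j\<in>?W. (h i, h j) \<notin> E"
    using embedding_extends[of ?W "{}" "{0, 1}" "{v, v'}" "\<lambda>i. if i = 0 then v else v'"] assms
    by (auto simp: perp_iff)
  have "h 2 \<noteq> h 0" "h 2 \<noteq> h 1"
    using h(1) by (auto simp: inj_on_def)
  then show ?thesis
    using h by (intro exI[of _ "h 2"]) (auto simp: perp_iff)
qed

lemma infinite_moved_parts:
  assumes "g \<in> Aut V E" "g \<noteq> id"
  shows "infinite {P \<in> parts V E. g ` P \<noteq> P}"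
proof
  assume fin: "finite {P \<in> parts V E. g ` P \<noteq> P}" (is "finite ?M")
  have perm: "g permutes V"
    and edge: "\<And>x y. x \<in> V \<Longrightarrow> y \<in> V \<Longrightarrow> (g x, g y) \<in> E \<longleftrightarrow> (x, y) \<in> E"
    using assms(1) by (auto simp: Aut_def graph_iso_def)
  have gV: "g x \<in> V \<longleftrightarrow> x \<in> V" for x
    by (rule permutes_in_image[OF perm])
  have g_perp: "(g x, g y) \<in> perp V E" if "(x, y) \<in> perp V E" for x y
    using that edge gV by (auto simp: perp_iff)
  have g_inj: "g x = g y \<longleftrightarrow> x = y" for x y
    using permutes_inj[OF perm] by (simp add: inj_eq)
  \<comment> \<open>One representative per part turns the finitely many moved parts into a finite
    set of vertices, to which a new vertex can be made adjacent.\<close>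
  define r :: "'a set \<Rightarrow> 'a" where "r P = (SOME x. x \<in> P)" for P
  have r: "r P \<in> P" if "P \<in> parts V E" for P
    using in_quotient_imp_non_empty[OF equiv_perp] that
    unfolding r_def parts_def by (simp add: some_in_eq)
  have part_sub: "P \<subseteq> V" if "P \<in> parts V E" for P
    using in_quotient_imp_subset[OF equiv_perp] that by (simp add: parts_def)
  have fresh: "\<exists>u\<in>V. (u, g u) \<in> perp V E \<and>
      (\<forall>a\<in>A. ((u, a) \<in> E \<longleftrightarrow> a \<in> S) \<and> ((a, u) \<in> E \<longleftrightarrow> a \<notin> S))"
    if A: "finite A" "A \<subseteq> V" for A S
  proof -
    have "r P \<in> V" if "P \<in> parts V E" for P
      using r[OF that] part_sub[OF that] by (rule subsetD[rotated])
    then have "finite (r ` ?M \<union> A)" "r ` ?M \<union> A \<subseteq> V"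
      using fin A by (simp_all add: image_subset_iff)
    from vertex_with_prescribed_edges[OF this, of S]
    obtain u where u: "u \<in> V"
      "\<forall>a\<in>r ` ?M \<union> A. ((u, a) \<in> E \<longleftrightarrow> a \<in> S) \<and> ((a, u) \<in> E \<longleftrightarrow> a \<notin> S)"
      by (rule bexE)
    let ?P = "perp V E `` {u}"
    have P: "?P \<in> parts V E"
      using u(1) by (auto simp: parts_def intro: quotientI)
    \<comment> \<open>If the part of \<open>u\<close> were moved, its representative would be among
      the vertices adjacent to \<open>u\<close>, although both lie in the same part.\<close>
    have "(u, r ?P) \<in> perp V E"
      using r[OF P] by simp
    then have "r ?P \<notin> r ` ?M"
      using u(2)[rule_format, of "r ?P"] by (auto simp only: perp_iff Un_iff)
    then have "?P \<notin> ?M"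
      by (rule contrapos_nn) (rule imageI)
    then have "g ` ?P = ?P"
      using P by simp
    moreover have "g u \<in> g ` ?P"
      by (intro imageI equiv_class_self[OF equiv_perp u(1)])
    ultimately have "(u, g u) \<in> perp V E"
      by simp
    then show ?thesis
      using u by (intro bexI[of _ u]) simp_all
  qed
  \<comment> \<open>For any moved \<open>x\<close>, whether or not its part is moved, a fresh
    \<open>u\<close> with an edge to \<open>x\<close> but none to \<open>g x\<close> cannot be
    fixed: \<open>g u = u\<close> would make the two edges equivalent. As the part of
    \<open>u\<close> is fixed, \<open>u\<close> can serve as \<open>v\<close>.\<close>
  obtain v where "g v \<noteq> v" "(v, g v) \<in> perp V E"
  proof -
    obtain x where x: "g x \<noteq> x"
      using assms(2) by fastforce
    then have xV: "x \<in> V"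
      using perm by (auto simp: permutes_def)
    obtain u where u: "u \<in> V" "(u, g u) \<in> perp V E" "(u, x) \<in> E" "(u, g x) \<notin> E"
      using fresh[of "{x, g x}" "{x}"] x xV gV by auto
    have "g u \<noteq> u"
      using edge[OF u(1) xV] u(3,4) by auto
    then show thesis
      using that u(2) by blast
  qed
  moreover from this obtain w where "(v, w) \<in> perp V E" "w \<noteq> v" "w \<noteq> g v"
    using third_vertex_in_part[of v "g v"] by auto
  ultimately have v: "g v \<noteq> v" and w: "w \<noteq> v" "w \<noteq> g v"
    and p: "(v, g v) \<in> perp V E" "(v, w) \<in> perp V E" and V: "v \<in> V" "w \<in> V"
    by (auto simp: perp_iff)
  \<comment> \<open>The set \<open>{v}\<close> separates \<open>v\<close> from \<open>g v\<close>
    and, unless \<open>g w = v\<close>, contains neither \<open>w\<close> nor \<open>g w\<close>. In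
    the exceptional case \<open>w\<close> is added, so that both are out-neighbours of
    \<open>u\<close>; \<open>g v\<close> stays outside because
    \<open>w \<noteq> g v\<close>.\<close>
  obtain u where u: "u \<in> V" "(u, g u) \<in> perp V E"
    "\<forall>a\<in>{v, g v, w, g w}. ((u, a) \<in> E \<longleftrightarrow> a \<in> (if g w = v then {v, w} else {v})) \<and>
      ((a, u) \<in> E \<longleftrightarrow> a \<notin> (if g w = v then {v, w} else {v}))"
    using fresh[of "{v, g v, w, g w}" "if g w = v then {v, w} else {v}"] V gV by auto
  have "(u, v) \<in> E" "(u, g v) \<notin> E" "(g v, u) \<in> E" "(u, w) \<in> E \<longleftrightarrow> (u, g w) \<in> E"
    using u(3) v w by (auto split: if_splits)
  \<comment> \<open>The vertex \<open>u\<close> has no edge to \<open>g v\<close>, but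
    \<open>g u\<close> has one, being the image of \<open>u \<rightarrow> v\<close>. Towards
    \<open>g w\<close> the two agree, because \<open>g u \<rightarrow> g w\<close> iff
    \<open>u \<rightarrow> w\<close> iff \<open>u \<rightarrow> g w\<close>. So the two sides of
    this equivalence have opposite truth values.\<close>
  moreover have "((u, g v) \<in> E \<longleftrightarrow> (u, g w) \<in> E) \<longleftrightarrow> ((g u, g v) \<in> E \<longleftrightarrow> (g u, g w) \<in> E)"
    using calculation(3) w(1) by (intro parity u(2) g_perp p(2)) (auto simp: perp_iff g_inj)
  ultimately show False
    using edge[OF u(1) V(1)] edge[OF u(1) V(2)] by blast
qed

end

theorem lemma7p12:
  fixes V :: "'a set" and E :: "'a rel" and g :: "'a \<Rightarrow> 'a"
  assumes "semigeneric_tournament V E"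
    and "g \<in> Aut V E - {id}"
  shows "infinite {P \<in> parts V E. g ` P \<noteq> P}"
  using infinite_moved_parts[OF assms(1)] assms(2) by blast

end
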